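(* For every integer $n\geq 1$, $|\mathrm{flat}(\mathcal{Q}_{n+1})|=D_n$, where $D_n$ is the $n$th Dowling number.
   Context: A Stirling permutation of order $N$ is a word $w=w_1w_2\cdots w_{2N}$ in which every letter of $\{1,\dots,N\}$ appears exactly twice and such that, for each $i$, every letter appearing between the two occurrences of $i$ is greater than $i$. $\mathcal{Q}_N$ is the set of Stirling permutations of order $N$. The runs of $w\in\mathcal{Q}_N$ are its maximal contiguous weakly increasing subwords. $w$ is flattened if the sequence of leading (first) terms of its runs, read from left to right, is weakly increasing. $\mathrm{flat}(\mathcal{Q}_N)$ is the set of flattened elements of $\mathcal{Q}_N$. The Dowling numbers $D_n$ (OEIS A007405) enumerate type $B$ set partitions: $D_n$ is the number of type $B$ set partitions of the set $[-n,n]$ of integers from $-n$ to $n$. A type $B$ set partition of $[-n,n]$ is a collection $\mathcal{B}$ of pairwise disjoint subsets (blocks) of $[-n,n]$ whose union is $[-n,n]$, such that (i) if $\beta\in\mathcal{B}$ then $-\beta:=\{-b: b\in\beta\}\in\mathcal{B}$, and (ii) there is exactly one block $\beta\in\mathcal{B}$ with $\beta=-\beta$. *)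

theory Defs
  imports Main "HOL-Library.Disjoint_Sets"
begin

definition stirling_permutations :: "nat \<Rightarrow> nat list set" where
  "stirling_permutations N =
    {w. length w = 2 * N \<and> set w \<subseteq> {1..N} \<and> (\<forall>i\<in>{1..N}. count_list w i = 2) \<and>
        (\<forall>a b c. a < b \<and> b < c \<and> c < length w \<and> w ! a = w ! c \<longrightarrow> w ! a < w ! b)}"

text \<open>Words are indexed from 0. A run is identified with its first and last position \<open>i \<le> j\<close>
  in the word, so that equal subwords at different places count as different runs.\<close>

definition is_run :: "nat list \<Rightarrow> nat \<Rightarrow> nat \<Rightarrow> bool" where
  "is_run w i j \<longleftrightarrow>
    i \<le> j \<and> j < length w \<and> sorted (nths w {i..j}) \<and>
    (\<forall>i' j'. i' \<le> i \<and> j \<le> j' \<and> j' < length w \<and> sorted (nths w {i'..j'}) \<longrightarrow> i' = i \<and> j' = j)"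

definition run_leaders :: "nat list \<Rightarrow> nat list" where
  "run_leaders w = nths w {i. \<exists>j. is_run w i j}"

definition flattened :: "nat list \<Rightarrow> bool" where
  "flattened w \<longleftrightarrow> sorted (run_leaders w)"

definition flat :: "nat list set \<Rightarrow> nat list set" where
  "flat Q = {w \<in> Q. flattened w}"

text \<open>The requirement in \<^const>\<open>partition_on\<close> that blocks be nonempty is no extra restriction:
  the block containing 0 is always equal to its negative, and so is the empty set,
  so the uniqueness condition already excludes an empty block.\<close>

definition type_B_partition :: "nat \<Rightarrow> int set set \<Rightarrow> bool" where
  "type_B_partition n P \<longleftrightarrow>
    partition_on {- int n..int n} P \<and>
    (\<forall>\<beta>\<in>P. uminus ` \<beta> \<in> P) \<and>
    (\<exists>!\<beta>. \<beta> \<in> P \<and> \<beta> = uminus ` \<beta>)"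

definition dowling :: "nat \<Rightarrow> nat" where
  "dowling n = card {P. type_B_partition n P}"

end

theory Submission
  imports Defs "HOL-Library.Multiset"
begin

text \<open>
  Once flattened words and type B partitions are stripped of their smallest letter and of their
  zero block, respectively, both kinds of rest satisfy the same set-indexed recursion.

  Apart from its first entry, the list of run leaders of a word consists of its descent bottoms,
  the letters smaller than their predecessor. Let the smallest letter \<open>m\<close> of a Stirling word cut
  it as \<open>u m v m z\<close>. Nesting forces \<open>u\<close>, \<open>v\<close>, \<open>z\<close> to have pairwise disjoint
  letter sets. If \<open>u\<close> is nonempty, the first \<open>m\<close> is a descent bottom preceded by
  the larger descent bottoms of \<open>u\<close>; so the descent bottoms can be
  sorted only if \<open>u\<close> has none at all; likewise for \<open>v\<close> and the second \<open>m\<close>.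
  An increasing word in which every letter occurs twice is determined by its letter set. Hence a
  Stirling word with sorted descent bottoms (an almost flattened word) is the same as a pair of
  disjoint sets \<open>X\<close>, \<open>Y\<close> of letters greater than \<open>m\<close> together with an almost
  flattened word \<open>z\<close> on the remaining letters (\<open>bij_betw_assemble_word\<close>). A word is
  flattened if moreover its first letter does not exceed its descent bottoms, that is, if
  \<open>X = {}\<close>; this leaves the sum over \<open>Y\<close> in \<open>card_flat_stirling_words\<close>.

  On the other side, call a partition of \<open>S \<union> -S\<close> that is closed under negation and has no
  block equal to its negative a signed partition of the set \<open>S\<close> of positive integers. No block
  of it contains both \<open>a\<close> and \<open>-a\<close>, so the block of \<open>m\<close> has the form
  \<open>{m} \<union> X \<union> -Y\<close> with \<open>X\<close>, \<open>Y\<close> disjoint, and removing it together with its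
  negative leaves a signed partition of the rest (\<open>bij_betw_attach_blocks\<close>). This is the
  recursion of the almost flattened words, so the two families are equinumerous. Finally a type B
  partition of \<open>[-n, n]\<close> is a zero block \<open>{0} \<union> A \<union> -A\<close> together with a signed partition
  of \<open>{1..n} - A\<close> (\<open>bij_betw_attach_zero_block\<close>), which matches the sum over \<open>Y\<close> for
  flattened words of order \<open>n + 1\<close>: the letter 1 plays the part of the number 0.
\<close>

section \<open>Run leaders and descent bottoms\<close>

fun descent_bottoms :: "'a::linorder list \<Rightarrow> 'a list" where
  "descent_bottoms (x # y # ys) = (if y < x then [y] else []) @ descent_bottoms (y # ys)"
| "descent_bottoms _ = []"

text \<open>Factors of a word in the sense of \<^const>\<open>is_run\<close> become ordinary lists, so that their
  sortedness can be tested on neighbouring letters.\<close>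
lemma nths_atLeastAtMost: "nths w {i..j} = take (Suc j - i) (drop i w)"
proof (induction w arbitrary: i j)
  case (Cons a w)
  have shift: "{k. Suc k \<in> {i..j}} = (if j = 0 then {} else {i - 1..j - 1})"
    by auto
  show ?case
    unfolding nths_Cons shift using Cons.IH[of "i - 1" "j - 1"]
    by (cases i; cases j) auto
qed simp

lemma sorted_factor_iff:
  assumes "j < length w"
  shows "sorted (nths w {i..j}) \<longleftrightarrow> (\<forall>k. i \<le> k \<and> k < j \<longrightarrow> w ! k \<le> w ! Suc k)"
proof -
  have "sorted (nths w {i..j}) \<longleftrightarrow> (\<forall>k. k < j - i \<longrightarrow> w ! (i + k) \<le> w ! Suc (i + k))"
    using assms by (auto simp: nths_atLeastAtMost sorted_iff_nth_Suc)
  also have "\<dots> \<longleftrightarrow> (\<forall>k. i \<le> k \<and> k < j \<longrightarrow> w ! k \<le> w ! Suc k)"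
  proof (intro iffI allI impI)
    fix k assume *: "\<forall>k. k < j - i \<longrightarrow> w ! (i + k) \<le> w ! Suc (i + k)" and k: "i \<le> k \<and> k < j"
    from k have "k - i < j - i" by arith
    with * have "w ! (i + (k - i)) \<le> w ! Suc (i + (k - i))" by blast
    with k show "w ! k \<le> w ! Suc k" by simp
  qed auto
  finally show ?thesis .
qed

text \<open>A sorted factor starting at \<open>i\<close> can be extended to the left exactly when the letter before it
  does not exceed \<open>w ! i\<close>; extending it to the right as far as possible never moves its start.\<close>
lemma run_start_iff:
  "(\<exists>j. is_run w i j) \<longleftrightarrow> i < length w \<and> (i = 0 \<or> w ! i < w ! (i - 1))"
proof
  assume "\<exists>j. is_run w i j"
  then obtain j where j: "i \<le> j" "j < length w" "sorted (nths w {i..j})"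
    and mx: "\<And>i' j'. i' \<le> i \<Longrightarrow> j \<le> j' \<Longrightarrow> j' < length w \<Longrightarrow> sorted (nths w {i'..j'}) \<Longrightarrow> i' = i"
    unfolding is_run_def by blast
  have "w ! i < w ! (i - 1)" if "i \<noteq> 0"
  proof (rule ccontr)
    assume "\<not> ?thesis"
    moreover have "k = i - 1 \<or> i \<le> k" if "i - 1 \<le> k" for k
      using that by linarith
    ultimately have "sorted (nths w {i - 1..j})"
      using j that by (fastforce simp: sorted_factor_iff)
    with mx[of "i - 1" j] j that show False by simp
  qed
  with j show "i < length w \<and> (i = 0 \<or> w ! i < w ! (i - 1))" by auto
next
  assume start: "i < length w \<and> (i = 0 \<or> w ! i < w ! (i - 1))"
  define J where "J = {j. i \<le> j \<and> j < length w \<and> sorted (nths w {i..j})}"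
  have J: "finite J" "i \<in> J"
    using start sorted_factor_iff[of i w i] by (auto simp: J_def)
  then have MJ: "Max J \<in> J" using Max_in by blast
  have "is_run w i (Max J)"
    unfolding is_run_def
  proof (intro conjI allI impI; (elim conjE)?)
    fix i' j' assume *: "i' \<le> i" "Max J \<le> j'" "j' < length w" "sorted (nths w {i'..j'})"
    have ij: "i \<le> j'" using * MJ by (auto simp: J_def)
    show "i' = i"
    proof (rule ccontr)
      assume "i' \<noteq> i"
      then have "i' \<le> i - 1" "i - 1 < j'" "Suc (i - 1) = i" "i \<noteq> 0" using * ij by auto
      then have "w ! (i - 1) \<le> w ! i"
        using * by (metis sorted_factor_iff)
      with start \<open>i \<noteq> 0\<close> show False by auto
    qed
    with * ij have "j' \<in> J" by (auto simp: J_def)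
    with J * show "j' = Max J" by (simp add: le_antisym)
  qed (use MJ in \<open>auto simp: J_def\<close>)
  then show "\<exists>j. is_run w i j" ..
qed

lemma run_leaders_Cons: "run_leaders (x # xs) = x # descent_bottoms (x # xs)"
proof -
  have "nths xs {i. i < length xs \<and> xs ! i < (x # xs) ! i} = descent_bottoms (x # xs)"
  proof (induction xs arbitrary: x)
    case (Cons y ys)
    then show ?case by (simp add: nths_Cons)
  qed simp
  then show ?thesis
    by (simp add: run_leaders_def run_start_iff nths_Cons)
qed

lemma set_descent_bottoms: "set (descent_bottoms w) \<subseteq> set w"
  by (induction w rule: descent_bottoms.induct) auto

lemma descent_bottoms_eq_Nil_iff: "descent_bottoms w = [] \<longleftrightarrow> sorted w"
  by (induction w rule: descent_bottoms.induct) (auto simp: not_less sorted2 sorted1 simp del: sorted_wrt.simps(2))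

lemma descent_bottoms_append_min:
  assumes "u \<noteq> []" "\<forall>x\<in>set u. m < x"
  shows "descent_bottoms (u @ m # v) = descent_bottoms u @ m # descent_bottoms (m # v)"
  using assms by (induction u rule: descent_bottoms.induct) auto

lemma descent_bottoms_min_Cons:
  "\<forall>x\<in>set v. m \<le> x \<Longrightarrow> descent_bottoms (m # v) = descent_bottoms v"
  by (cases v) auto

text \<open>The key step on words. Behind a nonempty \<open>u\<close> the letter \<open>m\<close> is a descent bottom, and
  any descent bottom of \<open>u\<close> would precede it and be larger. Behind \<open>m\<close> itself no descent
  occurs. The second hypothesis admits further copies of \<open>m\<close> in \<open>v\<close>, so the lemma can be
  applied at both occurrences of the smallest letter in turn.\<close>
lemma sorted_descent_bottoms_at_min:
  assumes "\<forall>x\<in>set u. m < x" "\<forall>x\<in>set v. m \<le> x"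
  shows "sorted (descent_bottoms (u @ m # v)) \<longleftrightarrow> sorted u \<and> sorted (descent_bottoms v)"
proof (cases "u = []")
  case False
  have "sorted (descent_bottoms u @ m # descent_bottoms v) \<longleftrightarrow>
    descent_bottoms u = [] \<and> sorted (descent_bottoms v)"
  proof
    assume s: "sorted (descent_bottoms u @ m # descent_bottoms v)"
    then have "\<forall>x\<in>set (descent_bottoms u). x \<le> m" by (auto simp: sorted_append)
    with assms(1) set_descent_bottoms[of u] have "set (descent_bottoms u) = {}"
      by (meson equals0I leD subsetD)
    with s show "descent_bottoms u = [] \<and> sorted (descent_bottoms v)" by simp
  next
    assume "descent_bottoms u = [] \<and> sorted (descent_bottoms v)"
    moreover have "\<forall>x\<in>set (descent_bottoms v). m \<le> x"
      using assms(2) set_descent_bottoms[of v] by blast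
    ultimately show "sorted (descent_bottoms u @ m # descent_bottoms v)" by simp
  qed
  with False assms show ?thesis
    by (simp add: descent_bottoms_append_min descent_bottoms_min_Cons descent_bottoms_eq_Nil_iff)
qed (use assms in \<open>simp add: descent_bottoms_min_Cons\<close>)

section \<open>Stirling words and their least letter\<close>

text \<open>The Stirling condition in terms of factorizations instead of positions: it then passes to
  factors by associativity of append alone.\<close>
definition nested :: "'a::linorder list \<Rightarrow> bool" where
  "nested w \<longleftrightarrow> (\<forall>p x q r. w = p @ x # q @ x # r \<longrightarrow> (\<forall>y\<in>set q. x < y))"

lemma nestedD: "nested w \<Longrightarrow> w = p @ x # q @ x # r \<Longrightarrow> y \<in> set q \<Longrightarrow> x < y"
  unfolding nested_def by blast

lemma nested_iff_nth:
  "nested w \<longleftrightarrow> (\<forall>a b c. a < b \<and> b < c \<and> c < length w \<and> w ! a = w ! c \<longrightarrow> w ! a < w ! b)"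
proof (intro iffI allI impI)
  fix a b c assume nest: "nested w" and abc: "a < b \<and> b < c \<and> c < length w \<and> w ! a = w ! c"
  define u where "u = drop (Suc a) w"
  define k where "k = c - Suc a"
  have "w = take a w @ w ! a # u"
    unfolding u_def using abc by (intro id_take_nth_drop) linarith
  moreover have "u = take k u @ u ! k # drop (Suc k) u"
    using abc by (intro id_take_nth_drop) (simp add: u_def k_def; linarith)
  moreover have "u ! k = w ! a" using abc by (simp add: u_def k_def)
  ultimately have "w = take a w @ w ! a # take k u @ w ! a # drop (Suc k) u" by metis
  moreover have "w ! b \<in> set (take k u)"
    unfolding in_set_conv_nth using abc by (intro exI[of _ "b - Suc a"]) (auto simp: u_def k_def)
  ultimately show "w ! a < w ! b" using nest nestedD by blast
next
  assume nth: "\<forall>a b c. a < b \<and> b < c \<and> c < length w \<and> w ! a = w ! c \<longrightarrow> w ! a < w ! b"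
  show "nested w"
    unfolding nested_def
  proof (intro allI impI ballI)
    fix p x q r y assume w: "w = p @ x # q @ x # r" and "y \<in> set q"
    then obtain k where k: "k < length q" "q ! k = y" by (auto simp: in_set_conv_nth)
    with nth[rule_format, of "length p" "length p + Suc k" "length p + Suc (length q)"]
    show "x < y" by (simp add: w nth_append)
  qed
qed

text \<open>With disjoint letter sets, two equal letters of \<open>u @ v\<close> lie in the same factor, and so does
  everything between them.\<close>
lemma nested_append:
  assumes "set u \<inter> set v = {}"
  shows "nested (u @ v) \<longleftrightarrow> nested u \<and> nested v"
proof (intro iffI conjI)
  assume nest: "nested (u @ v)"
  show "nested u" "nested v"
    unfolding nested_def
  proof (intro allI impI)
    fix p x q r assume "u = p @ x # q @ x # r"
    with nestedD[OF nest, of p x q "r @ v"] show "\<forall>y\<in>set q. x < y" by auto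
  next
    show "\<forall>p x q r. v = p @ x # q @ x # r \<longrightarrow> (\<forall>y\<in>set q. x < y)"
    proof (intro allI impI)
      fix p x q r assume "v = p @ x # q @ x # r"
      with nestedD[OF nest, of "u @ p" x q r] show "\<forall>y\<in>set q. x < y" by auto
    qed
  qed
next
  assume nest: "nested u \<and> nested v"
  show "nested (u @ v)"
    unfolding nested_def
  proof (intro allI impI ballI)
    fix p x q r y assume w: "u @ v = p @ x # q @ x # r" and y: "y \<in> set q"
    from w consider (left) s where "u = p @ s" "s @ v = x # q @ x # r"
      | (right) s where "v = s @ x # q @ x # r"
      by (auto simp: append_eq_append_conv2)
    then show "x < y"
    proof cases
      case left
      show ?thesis
      proof (cases s)
        case Nil
        with left have "v = [] @ x # q @ x # r" by simp
        with nest y nestedD show ?thesis by blast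
      next
        case (Cons a s')
        with left have u: "u = p @ x # s'" and "s' @ v = q @ x # r" by auto
        moreover from this have "length q \<le> length s'"
          using assms by (fastforce simp: append_eq_append_conv2)
        ultimately obtain t where "s' = q @ t" "t @ v = x # r"
          by (auto simp: append_eq_append_conv2)
        moreover have "t \<noteq> []" using assms u calculation by auto
        ultimately have "u = p @ x # q @ x # tl t" using u by (cases t) auto
        with nest y nestedD show ?thesis by blast
      qed
    next
      case right
      with nest y nestedD show ?thesis by blast
    qed
  qed
qed

lemma nested_bracket:
  assumes "m \<notin> set u"
  shows "nested (m # u @ [m]) \<longleftrightarrow> nested u \<and> (\<forall>y\<in>set u. m < y)"
proof -
  (* A final letter that occurs nowhere else closes no pair. *)
  have nest_right: "nested (u @ [m]) \<longleftrightarrow> nested u"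
    using assms nested_append[of u "[m]"] by (simp add: nested_def append_eq_Cons_conv Cons_eq_append_conv)
  show ?thesis
  proof (intro iffI conjI ballI)
    assume nest: "nested (m # u @ [m])"
    then have "nested (u @ [m])"
      using nestedD[OF nest, of "m # _"] unfolding nested_def by auto
    with nest_right show "nested u" by simp
    show "m < y" if "y \<in> set u" for y
      using nestedD[OF nest, of "[]" m u "[]" y] that by simp
  next
    assume nest: "nested u \<and> (\<forall>y\<in>set u. m < y)"
    show "nested (m # u @ [m])"
      unfolding nested_def
    proof (intro allI impI ballI)
      fix p x q r y assume w: "m # u @ [m] = p @ x # q @ x # r" and y: "y \<in> set q"
      show "x < y"
      proof (cases p)
        case Nil
        with w have "x = m" "u @ [m] = q @ m # r" by auto
        with assms have "q = u"
          by (auto simp: append_eq_append_conv2 append_eq_Cons_conv Cons_eq_append_conv)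
        with nest y \<open>x = m\<close> show ?thesis by simp
      next
        case (Cons a p')
        with w nest nest_right y show ?thesis by (auto dest: nestedD)
      qed
    qed
  qed
qed

text \<open>A letter greater than \<open>m\<close> on both sides of \<open>m\<close> would enclose a smaller letter.\<close>
lemma nested_letter_one_side:
  assumes "nested (u @ m # v)" "m < x" "x \<in> set u"
  shows "x \<notin> set v"
proof
  assume "x \<in> set v"
  then obtain p q q' r where "u = p @ x # q" "v = q' @ x # r"
    using assms by (metis split_list)
  then have "x < m" using nestedD[OF assms(1), of p x "q @ m # q'" r m] by simp
  with assms show False by simp
qed

text \<open>The weakly increasing word in which every letter of \<open>U\<close> occurs exactly twice.\<close>
definition pair_up :: "'a::linorder set \<Rightarrow> 'a list" where
  "pair_up U = sorted_list_of_multiset (mset_set U + mset_set U)"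

lemma sorted_pair_up: "sorted (pair_up U)"
  by (simp add: pair_up_def)

lemma set_pair_up [simp]: "finite U \<Longrightarrow> set (pair_up U) = U"
  by (simp add: pair_up_def)

lemma count_list_pair_up: "finite U \<Longrightarrow> count_list (pair_up U) x = (if x \<in> U then 2 else 0)"
  by (simp add: pair_up_def flip: count_mset)

lemma sorted_eq_pair_up:
  assumes "sorted w" "\<forall>x\<in>set w. count_list w x = 2"
  shows "w = pair_up (set w)"
proof -
  have "mset w = mset (pair_up (set w))"
  proof (rule multiset_eqI)
    fix x show "count (mset w) x = count (mset (pair_up (set w))) x"
      using assms(2) by (cases "x \<in> set w") (auto simp: count_mset count_list_pair_up)
  qed
  then show ?thesis
    using assms(1) sorted_pair_up by (metis properties_for_sort)
qed

text \<open>Stirling permutations of an arbitrary set of letters, as the pieces cut off by the smallest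
  letter no longer use an initial segment of the numbers.\<close>
definition stirling_words :: "'a::linorder set \<Rightarrow> 'a list set" where
  "stirling_words S = {w. set w = S \<and> (\<forall>x\<in>S. count_list w x = 2) \<and> nested w}"

lemma stirling_permutations_eq: "stirling_permutations N = stirling_words {1..N}"
proof -
  have "length w = 2 * N \<and> set w \<subseteq> {1..N} \<longleftrightarrow> set w = {1..N}"
    if c: "\<forall>x\<in>{1..N}. count_list w x = 2" for w :: "nat list"
  proof -
    have "{1..N} \<subseteq> set w"
      using c by (metis count_notin subsetI zero_neq_numeral)
    moreover have "length w = 2 * N" if "set w = {1..N}"
      using sum_count_set[of w "{1..N}"] that c by simp
    ultimately show ?thesis by blast
  qed
  then show ?thesis
    unfolding stirling_permutations_def stirling_words_def nested_iff_nth by blast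
qed

lemma finite_stirling_words:
  assumes "finite S"
  shows "finite (stirling_words S)"
proof (rule finite_subset)
  show "stirling_words S \<subseteq> {w. set w \<subseteq> S \<and> length w = 2 * card S}"
    using assms by (auto simp: stirling_words_def simp flip: sum_count_set[OF order_refl])
  show "finite {w. set w \<subseteq> S \<and> length w = 2 * card S}"
    using assms by (rule finite_lists_length_eq)
qed

text \<open>In a sorted word only copies of \<open>x\<close> fit between two copies of \<open>x\<close>, and there are no
  more than two.\<close>
lemma pair_up_in_stirling_words:
  assumes "finite U"
  shows "pair_up U \<in> stirling_words U"
proof -
  have "nested (pair_up U)"
    unfolding nested_def
  proof (intro allI impI ballI)
    fix p x q r y assume w: "pair_up U = p @ x # q @ x # r" and y: "y \<in> set q"
    have "x \<in> U" using w assms by (metis set_pair_up in_set_conv_decomp)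
    with w have "count_list (p @ x # q @ x # r) x = 2"
      using assms by (metis count_list_pair_up)
    then have "count_list q x = 0" by simp
    then have "x \<noteq> y" using y by (auto simp: count_list_0_iff)
    moreover have "x \<le> y" using sorted_pair_up[of U] y by (auto simp: w sorted_append)
    ultimately show "x < y" by simp
  qed
  with assms show ?thesis by (simp add: stirling_words_def count_list_pair_up)
qed

text \<open>A letter greater than \<open>m\<close> cannot have its two copies on different sides of an \<open>m\<close>, so
  the three pieces share no letter and each contains both copies of its letters.\<close>
lemma stirling_words_decompose:
  assumes w: "w \<in> stirling_words (insert m R)" and m: "\<forall>x\<in>R. m < x"
  obtains u v z where "w = u @ m # v @ m # z"
    "set u \<subseteq> R" "set v \<subseteq> R - set u"
    "u \<in> stirling_words (set u)" "v \<in> stirling_words (set v)"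
    "z \<in> stirling_words (R - set u - set v)"
proof -
  have set: "set w = insert m R" and c: "\<forall>x\<in>insert m R. count_list w x = 2" and nest: "nested w"
    using w by (auto simp: stirling_words_def)
  obtain u s where us: "w = u @ m # s" "m \<notin> set u"
    using set by (metis insertI1 split_list_first)
  then have "count_list s m = 1" using c by simp
  then obtain v z where vz: "s = v @ m # z" "m \<notin> set v"
    by (metis count_notin split_list_first zero_neq_one)
  with \<open>count_list s m = 1\<close> have "m \<notin> set z" by (simp add: count_list_0_iff)
  have w_eq: "w = u @ m # v @ m # z" using us vz by simp
  have sets: "set u \<union> set v \<union> set z = R"
    using set us vz \<open>m \<notin> set z\<close> m by auto
  have disj: "set u \<inter> (set v \<union> set z) = {}" "set v \<inter> set z = {}"
    using nested_letter_one_side[of u m "v @ m # z"] nested_letter_one_side[of "u @ m # v" m z]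
      nest sets m by (auto simp: w_eq)
  have "set u \<inter> set ((m # v @ [m]) @ z) = {}" "set (m # v @ [m]) \<inter> set z = {}"
    using disj us \<open>m \<notin> set z\<close> by auto
  moreover have "nested (u @ (m # v @ [m]) @ z)" using nest by (simp add: w_eq)
  ultimately have "nested u" "nested (m # v @ [m])" "nested z"
    by (metis nested_append)+
  then have n: "nested u" "nested v" "nested z"
    using nested_bracket vz by blast+
  have cw: "count_list u x + count_list v x + count_list z x = 2" if "x \<in> R" for x
  proof -
    have "m \<noteq> x" using that m by blast
    with c that show ?thesis by (auto simp: w_eq)
  qed
  have "count_list u x = 2" if "x \<in> set u" for x
  proof -
    have "x \<notin> set v" "x \<notin> set z" "x \<in> R" using that disj sets by auto
    with cw[of x] show ?thesis by simp
  qed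
  moreover have "count_list v x = 2" if "x \<in> set v" for x
  proof -
    have "x \<notin> set u" "x \<notin> set z" "x \<in> R" using that disj sets by auto
    with cw[of x] show ?thesis by simp
  qed
  moreover have "count_list z x = 2" if "x \<in> set z" for x
  proof -
    have "x \<notin> set u" "x \<notin> set v" "x \<in> R" using that disj sets by auto
    with cw[of x] show ?thesis by simp
  qed
  moreover have z: "R - set u - set v = set z" using sets disj by auto
  ultimately have "u \<in> stirling_words (set u)" "v \<in> stirling_words (set v)"
    "z \<in> stirling_words (R - set u - set v)"
    unfolding z using n by (simp_all add: stirling_words_def)
  then show ?thesis
    using that[OF w_eq] sets disj by blast
qed

lemma stirling_words_compose:
  assumes m: "\<forall>x\<in>R. m < x" and sub: "set u \<subseteq> R" "set v \<subseteq> R - set u"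
    and st: "u \<in> stirling_words (set u)" "v \<in> stirling_words (set v)"
      "z \<in> stirling_words (R - set u - set v)"
  shows "u @ m # v @ m # z \<in> stirling_words (insert m R)"
proof -
  have z: "set z = R - set u - set v" using st by (simp add: stirling_words_def)
  have nm: "m \<notin> set u" "m \<notin> set v" "m \<notin> set z" using m sub z by auto
  have "nested (m # v @ [m])"
    using st nm m sub by (subst nested_bracket) (auto simp: stirling_words_def)
  moreover have "set u \<inter> set ((m # v @ [m]) @ z) = {}" "set (m # v @ [m]) \<inter> set z = {}"
    using nm sub z by auto
  ultimately have "nested (u @ (m # v @ [m]) @ z)"
    using st by (simp add: nested_append stirling_words_def del: append.simps append_assoc)
  moreover have "count_list (u @ m # v @ m # z) x = 2" if "x \<in> insert m R" for x
  proof -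
    from that z consider "x = m" | "x \<in> set u" | "x \<in> set v" | "x \<in> set z" by blast
    then show ?thesis
    proof cases
      case 1
      with nm show ?thesis by simp
    next
      case 2
      then have "x \<noteq> m" "x \<notin> set v" "x \<notin> set z" using nm sub z by auto
      with 2 st show ?thesis by (auto simp: stirling_words_def)
    next
      case 3
      then have "x \<noteq> m" "x \<notin> set u" "x \<notin> set z" using nm sub z by auto
      with 3 st show ?thesis by (auto simp: stirling_words_def)
    next
      case 4
      then have "x \<noteq> m" "x \<notin> set u" "x \<notin> set v" using nm sub z by auto
      with 4 st z show ?thesis by (auto simp: stirling_words_def)
    qed
  qed
  moreover have "set (u @ m # v @ m # z) = insert m R" using sub z by auto
  ultimately show ?thesis by (simp add: stirling_words_def del: count_list_append)
qed

section \<open>Words with sorted descent bottoms\<close>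

definition almost_flattened :: "'a::linorder set \<Rightarrow> 'a list set" where
  "almost_flattened S = {w \<in> stirling_words S. sorted (descent_bottoms w)}"

definition assemble_word :: "'a::linorder \<Rightarrow> 'a set \<times> 'a set \<times> 'a list \<Rightarrow> 'a list" where
  "assemble_word m = (\<lambda>(X, Y, z). pair_up X @ m # pair_up Y @ m # z)"

lemma append_Cons_cancel:
  assumes "u @ m # v = u' @ m # v'" "m \<notin> set u" "m \<notin> set u'"
  shows "u = u' \<and> v = v'"
  using assms by (auto simp: append_eq_append_conv2 append_eq_Cons_conv Cons_eq_append_conv)

text \<open>The recursion for words. By \<open>sorted_descent_bottoms_at_min\<close>, used at both copies of
  \<open>m\<close>, the pieces before and between the copies are sorted, hence determined by their letter sets.
  Conversely the first two occurrences of \<open>m\<close> recover all three pieces.\<close>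
lemma bij_betw_assemble_word:
  assumes R: "finite R" "\<forall>x\<in>R. m < x"
  shows "bij_betw (assemble_word m)
    (SIGMA X:Pow R. SIGMA Y:Pow (R - X). almost_flattened (R - X - Y)) (almost_flattened (insert m R))"
    (is "bij_betw _ ?D _")
proof (rule bij_betw_imageI)
  have fin: "finite X" if "X \<subseteq> R" for X
    using that R(1) finite_subset by blast
  show "inj_on (assemble_word m) ?D"
  proof (rule inj_onI)
    fix p p' assume "p \<in> ?D" "p' \<in> ?D" and eq_p: "assemble_word m p = assemble_word m p'"
    then obtain X Y z X' Y' z' where p: "p = (X, Y, z)" "p' = (X', Y', z')"
      and sub: "X \<subseteq> R" "Y \<subseteq> R - X" "X' \<subseteq> R" "Y' \<subseteq> R - X'" by auto
    note eq = eq_p[unfolded p]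
    have f: "finite X" "finite Y" "finite X'" "finite Y'" using sub fin by blast+
    have nm: "m \<notin> X" "m \<notin> Y" "m \<notin> X'" "m \<notin> Y'" using sub R(2) by auto
    from eq have "pair_up X = pair_up X' \<and> pair_up Y @ m # z = pair_up Y' @ m # z'"
      unfolding assemble_word_def by (intro append_Cons_cancel) (use f nm in auto)
    moreover from this have "pair_up Y = pair_up Y' \<and> z = z'"
      by (intro append_Cons_cancel[of _ m]) (use f nm in auto)
    ultimately show "p = p'"
      unfolding p using f by (metis set_pair_up)
  qed
  show "assemble_word m ` ?D = almost_flattened (insert m R)"
  proof (intro equalityI subsetI)
    fix w assume "w \<in> assemble_word m ` ?D"
    then obtain X Y z where w: "w = pair_up X @ m # pair_up Y @ m # z"
      and sub: "X \<subseteq> R" "Y \<subseteq> R - X" and z: "z \<in> almost_flattened (R - X - Y)"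
      by (auto simp: assemble_word_def)
    have f: "finite X" "finite Y" using sub fin by blast+
    have "w \<in> stirling_words (insert m R)"
      unfolding w using R(2) sub f z pair_up_in_stirling_words
      by (intro stirling_words_compose) (auto simp: almost_flattened_def)
    moreover have setz: "set z = R - X - Y" using z by (simp add: almost_flattened_def stirling_words_def)
    have "sorted (descent_bottoms w)"
      unfolding w
    proof (subst sorted_descent_bottoms_at_min)
      show "\<forall>x\<in>set (pair_up X). m < x" using R(2) sub f by auto
      show "\<forall>x\<in>set (pair_up Y @ m # z). m \<le> x" using R(2) sub f setz by (auto intro: less_imp_le)
      have "\<forall>x\<in>set (pair_up Y). m < x" "\<forall>x\<in>set z. m \<le> x"
        using R(2) sub f setz by (auto intro: less_imp_le)
      then have "sorted (descent_bottoms (pair_up Y @ m # z))"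
        using z sorted_pair_up by (auto simp: sorted_descent_bottoms_at_min almost_flattened_def)
      then show "sorted (pair_up X) \<and> sorted (descent_bottoms (pair_up Y @ m # z))"
        using sorted_pair_up by blast
    qed
    ultimately show "w \<in> almost_flattened (insert m R)" by (simp add: almost_flattened_def)
  next
    fix w assume w: "w \<in> almost_flattened (insert m R)"
    then obtain u v z where w_eq: "w = u @ m # v @ m # z"
      and sub: "set u \<subseteq> R" "set v \<subseteq> R - set u"
      and st: "u \<in> stirling_words (set u)" "v \<in> stirling_words (set v)"
        "z \<in> stirling_words (R - set u - set v)"
      using R(2) by (auto simp: almost_flattened_def elim!: stirling_words_decompose)
    have setz: "set z = R - set u - set v" using st by (simp add: stirling_words_def)
    have gt: "\<forall>x\<in>set u. m < x" "\<forall>x\<in>set v. m < x" "\<forall>x\<in>set z. m \<le> x"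
      "\<forall>x\<in>set (v @ m # z). m \<le> x"
      using R(2) sub setz by (auto intro: less_imp_le)
    have "sorted u" "sorted v" "sorted (descent_bottoms z)"
      using w sorted_descent_bottoms_at_min[OF gt(1,4)] sorted_descent_bottoms_at_min[OF gt(2,3)]
      by (auto simp: almost_flattened_def w_eq)
    then have "u = pair_up (set u)" "v = pair_up (set v)" "z \<in> almost_flattened (R - set u - set v)"
      using st by (auto intro!: sorted_eq_pair_up simp: stirling_words_def almost_flattened_def)
    then have "w = assemble_word m (set u, set v, z)" "(set u, set v, z) \<in> ?D"
      using sub by (auto simp: assemble_word_def w_eq)
    then show "w \<in> assemble_word m ` ?D" by blast
  qed
qed

lemma finite_almost_flattened [simp]: "finite S \<Longrightarrow> finite (almost_flattened S)"
  by (simp add: almost_flattened_def finite_stirling_words)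

lemma card_almost_flattened_insert:
  assumes "finite R" "\<forall>x\<in>R. m < x"
  shows "card (almost_flattened (insert m R)) =
    (\<Sum>X\<in>Pow R. \<Sum>Y\<in>Pow (R - X). card (almost_flattened (R - X - Y)))"
proof -
  have "card (almost_flattened (insert m R)) =
    card (SIGMA X:Pow R. SIGMA Y:Pow (R - X). almost_flattened (R - X - Y))"
    using bij_betw_same_card[OF bij_betw_assemble_word[OF assms]] by simp
  also have "\<dots> = (\<Sum>X\<in>Pow R. \<Sum>Y\<in>Pow (R - X). card (almost_flattened (R - X - Y)))"
    using assms(1) by (simp add: finite_almost_flattened)
  finally show ?thesis .
qed

lemma flattened_iff:
  assumes "w \<noteq> []"
  shows "flattened w \<longleftrightarrow> sorted (descent_bottoms w) \<and> (\<forall>y\<in>set (descent_bottoms w). hd w \<le> y)"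
  using assms by (cases w) (auto simp: flattened_def run_leaders_Cons)

lemma flattened_imp_sorted_descent_bottoms: "flattened w \<Longrightarrow> sorted (descent_bottoms w)"
  by (cases "w = []") (simp_all add: flattened_iff)

text \<open>A flattened word starts with its smallest letter: otherwise the first occurrence of that letter
  is a run leader below the first one.\<close>
lemma flattened_at_min_iff:
  assumes "\<forall>x\<in>set u. m < x" "\<forall>x\<in>set v. m \<le> x"
  shows "flattened (u @ m # v) \<longleftrightarrow> u = [] \<and> sorted (descent_bottoms v)"
proof (cases "u = []")
  case True
  have "\<forall>y\<in>set (descent_bottoms v). m \<le> y"
    using assms(2) set_descent_bottoms by blast
  with True assms show ?thesis by (simp add: flattened_iff descent_bottoms_min_Cons)
next
  case False
  then have "m \<in> set (descent_bottoms (u @ m # v))" "m < hd (u @ m # v)"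
    using assms(1) by (auto simp: descent_bottoms_append_min)
  with False show ?thesis by (metis append_is_Nil_conv flattened_iff leD)
qed

lemma card_flat_stirling_words:
  assumes R: "finite R" "\<forall>x\<in>R. m < x"
  shows "card (flat (stirling_words (insert m R))) = (\<Sum>Y\<in>Pow R. card (almost_flattened (R - Y)))"
proof -
  let ?D = "SIGMA X:Pow R. SIGMA Y:Pow (R - X). almost_flattened (R - X - Y)"
  let ?E = "{{} :: nat set} \<times> (SIGMA Y:Pow R. almost_flattened (R - Y))"
  have flat_iff: "flattened (assemble_word m (X, Y, z)) \<longleftrightarrow> X = {}" if "(X, Y, z) \<in> ?D" for X Y z
  proof -
    have f: "finite X" "finite Y" and sub: "X \<subseteq> R" "Y \<subseteq> R" and z: "z \<in> almost_flattened (R - X - Y)"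
      using that R(1) by (auto intro: finite_subset)
    have setz: "set z \<subseteq> R" using z by (auto simp: almost_flattened_def stirling_words_def)
    have gt: "\<forall>x\<in>set (pair_up X). m < x" "\<forall>x\<in>set (pair_up Y). m < x"
      "\<forall>x\<in>set z. m \<le> x" "\<forall>x\<in>set (pair_up Y @ m # z). m \<le> x"
      using R(2) sub f setz by (auto intro: less_imp_le)
    have "sorted (descent_bottoms (pair_up Y @ m # z))"
      using z sorted_pair_up sorted_descent_bottoms_at_min[OF gt(2,3)] by (auto simp: almost_flattened_def)
    then have "flattened (assemble_word m (X, Y, z)) \<longleftrightarrow> pair_up X = []"
      using flattened_at_min_iff[OF gt(1,4)] by (simp add: assemble_word_def)
    also have "\<dots> \<longleftrightarrow> X = {}" using f by (metis set_empty set_pair_up)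
    finally show ?thesis .
  qed
  have flat_iff_fst: "flattened (assemble_word m p) \<longleftrightarrow> fst p = {}" if "p \<in> ?D" for p
    using that flat_iff[of "fst p" "fst (snd p)" "snd (snd p)"] by simp
  have "flat (stirling_words (insert m R)) = {w \<in> almost_flattened (insert m R). flattened w}"
    by (auto simp: flat_def almost_flattened_def dest: flattened_imp_sorted_descent_bottoms)
  also have "\<dots> = assemble_word m ` ?E"
  proof -
    have "{w \<in> assemble_word m ` ?D. flattened w} = assemble_word m ` {p \<in> ?D. fst p = {}}"
      using flat_iff_fst by blast
    moreover have "{p \<in> ?D. fst p = {}} = ?E" by auto
    ultimately show ?thesis
      by (simp only: bij_betw_imp_surj_on[OF bij_betw_assemble_word[OF R]])
  qed
  finally have "flat (stirling_words (insert m R)) = assemble_word m ` ?E" .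
  moreover have "inj_on (assemble_word m) ?E"
    by (rule inj_on_subset[OF bij_betw_imp_inj_on[OF bij_betw_assemble_word[OF R]]]) auto
  ultimately have "card (flat (stirling_words (insert m R))) = card ?E"
    by (simp add: card_image)
  also have "\<dots> = (\<Sum>Y\<in>Pow R. card (almost_flattened (R - Y)))"
    using R(1) by (simp add: card_cartesian_product finite_almost_flattened)
  finally show ?thesis .
qed

section \<open>Type B partitions and signed partitions\<close>

lemma mem_uminus_image: "x \<in> uminus ` S \<longleftrightarrow> - x \<in> S" for x :: "'a::group_add"
  by force

lemma disjnt_Union_other_blocks:
  assumes "disjoint Q" "b \<in> Q" "P \<subseteq> Q" "b \<notin> P"
  shows "disjnt b (\<Union>P)"
  using assms by (metis disjnt_Union2 pairwiseD subsetD)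

text \<open>The part of a type B partition away from its zero block. For a set \<open>S\<close> of positive integers
  these correspond to set partitions of \<open>S\<close> in which every element other than the minimum of its
  block carries a sign.\<close>
definition signed_partitions :: "int set \<Rightarrow> int set set set" where
  "signed_partitions S =
    {P. partition_on (S \<union> uminus ` S) P \<and> (\<forall>\<beta>\<in>P. uminus ` \<beta> \<in> P \<and> uminus ` \<beta> \<noteq> \<beta>)}"

text \<open>The second of the two new blocks is the negative of the first.\<close>
definition attach_blocks :: "int \<Rightarrow> int set \<times> int set \<times> int set set \<Rightarrow> int set set" where
  "attach_blocks m = (\<lambda>(X, Y, P).
    insert (insert m (X \<union> uminus ` Y)) (insert (insert (- m) (uminus ` X \<union> Y)) P))"

lemma uminus_image_uminus_image: "uminus ` uminus ` S = S" for S :: "'a::group_add set"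
  by (simp add: image_image)

lemma Union_signed_partitions: "P \<in> signed_partitions S \<Longrightarrow> \<Union>P = S \<union> uminus ` S"
  by (simp add: signed_partitions_def partition_on_def)

text \<open>The recursion for partitions. The block \<open>\<beta>\<close> of \<open>m\<close> is disjoint from its negative, as
  otherwise the two would coincide; so the positive elements of \<open>\<beta>\<close> and of \<open>-\<beta>\<close>,
  apart from \<open>m\<close>, form disjoint sets \<open>X\<close> and \<open>Y\<close> that determine \<open>\<beta>\<close>.\<close>
lemma bij_betw_attach_blocks:
  assumes m: "m \<notin> R" and pos: "\<forall>x\<in>insert m R. 0 < x"
  shows "bij_betw (attach_blocks m)
    (SIGMA X:Pow R. SIGMA Y:Pow (R - X). signed_partitions (R - X - Y)) (signed_partitions (insert m R))"
    (is "bij_betw _ ?D _")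
proof (rule bij_betw_imageI)
  have neg: "- x \<notin> insert m R" if "x \<in> insert m R" for x
    using that pos by (metis neg_0_less_iff_less order_less_asym)
  show "inj_on (attach_blocks m) ?D"
  proof (rule inj_onI)
    fix p p' assume "p \<in> ?D" "p' \<in> ?D" and eq_p: "attach_blocks m p = attach_blocks m p'"
    then obtain X Y P X' Y' P' where p: "p = (X, Y, P)" "p' = (X', Y', P')"
      and sub: "X \<subseteq> R" "Y \<subseteq> R - X" "X' \<subseteq> R" "Y' \<subseteq> R - X'"
      and P: "P \<in> signed_partitions (R - X - Y)" "P' \<in> signed_partitions (R - X' - Y')"
      by auto
    define \<beta> \<beta>' where "\<beta> = insert m (X \<union> uminus ` Y)" and "\<beta>' = insert m (X' \<union> uminus ` Y')"
    define \<gamma> \<gamma>' where "\<gamma> = insert (- m) (uminus ` X \<union> Y)" and "\<gamma>' = insert (- m) (uminus ` X' \<union> Y')"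
    note defs = \<beta>_def \<beta>'_def \<gamma>_def \<gamma>'_def
    have un: "m \<notin> \<Union>P" "m \<notin> \<Union>P'" "- m \<notin> \<Union>P" "- m \<notin> \<Union>P'"
      using m neg by (auto simp: P[THEN Union_signed_partitions] mem_uminus_image simp del: Union_iff)
    have mm: "m \<in> \<beta>" "m \<in> \<beta>'" "m \<notin> \<gamma>" "m \<notin> \<gamma>'" "- m \<in> \<gamma>" "- m \<in> \<gamma>'" "- m \<notin> \<beta>" "- m \<notin> \<beta>'"
      using sub m neg pos by (auto simp: defs mem_uminus_image)
    have eq: "insert \<beta> (insert \<gamma> P) = insert \<beta>' (insert \<gamma>' P')"
      using eq_p by (simp add: p attach_blocks_def defs)
    then have "\<beta> = \<beta>'" "\<gamma> = \<gamma>'" using un mm by blast+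
    have "P = insert \<beta> (insert \<gamma> P) - {\<beta>, \<gamma>}" "P' = insert \<beta>' (insert \<gamma>' P') - {\<beta>', \<gamma>'}"
      using un mm by blast+
    then have "P = P'" using eq \<open>\<beta> = \<beta>'\<close> \<open>\<gamma> = \<gamma>'\<close> by metis
    moreover have "X = \<beta> \<inter> R" "X' = \<beta>' \<inter> R" "Y = \<gamma> \<inter> R" "Y' = \<gamma>' \<inter> R"
      using sub m neg by (auto simp: defs mem_uminus_image)
    ultimately show "p = p'" unfolding p using \<open>\<beta> = \<beta>'\<close> \<open>\<gamma> = \<gamma>'\<close> by blast
  qed
  (* The equivalence serves both inclusions: attaching a block pair to P, and removing it from Q. *)
  have shape: "attach_blocks m (X, Y, P) \<in> signed_partitions (insert m R) \<longleftrightarrow> P \<in> signed_partitions (R - X - Y)"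
    if sub: "X \<subseteq> R" "Y \<subseteq> R - X"
      and disj: "disjnt (insert m (X \<union> uminus ` Y)) (\<Union>P)" "disjnt (insert (- m) (uminus ` X \<union> Y)) (\<Union>P)"
    for X Y P
  proof -
    define \<beta> where "\<beta> = insert m (X \<union> uminus ` Y)"
    define \<gamma> where "\<gamma> = insert (- m) (uminus ` X \<union> Y)"
    have img: "uminus ` \<beta> = \<gamma>" "uminus ` \<gamma> = \<beta>"
      by (simp_all add: \<beta>_def \<gamma>_def image_Un image_image)
    have R: "0 < m" "\<And>x. x \<in> R \<Longrightarrow> 0 < x \<and> x \<noteq> m \<and> - x \<notin> R"
      using pos m neg by blast+
    have X: "\<And>x. x \<in> X \<Longrightarrow> 0 < x \<and> x \<in> R \<and> - x \<notin> R \<and> x \<noteq> m \<and> x \<notin> Y"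
      and Y: "\<And>x. x \<in> Y \<Longrightarrow> 0 < x \<and> x \<in> R \<and> - x \<notin> R \<and> x \<noteq> m \<and> x \<notin> X"
      using sub R by blast+
    have bg: "\<beta> \<inter> \<gamma> = {}"
      using R by (auto simp: \<beta>_def \<gamma>_def mem_uminus_image dest: X Y)
    have ne: "\<beta> \<noteq> \<gamma>" using bg by (auto simp: \<beta>_def)
    have dj: "disjnt \<beta> (\<Union>(insert \<gamma> P))" "disjnt \<gamma> (\<Union>P)"
      using disj bg by (auto simp: disjnt_def \<beta>_def[symmetric] \<gamma>_def[symmetric])
    have rest: "(insert m R \<union> uminus ` insert m R) - \<beta> - \<gamma> = (R - X - Y) \<union> uminus ` (R - X - Y)"
      using R by (auto simp: \<beta>_def \<gamma>_def mem_uminus_image dest: X Y R(2))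
    have in_A: "\<beta> \<subseteq> insert m R \<union> uminus ` insert m R" "\<gamma> \<subseteq> (insert m R \<union> uminus ` insert m R) - \<beta>"
      using sub bg by (auto simp: \<beta>_def \<gamma>_def mem_uminus_image)
    have part: "partition_on (insert m R \<union> uminus ` insert m R) (insert \<beta> (insert \<gamma> P)) \<longleftrightarrow>
        partition_on ((R - X - Y) \<union> uminus ` (R - X - Y)) P"
      using in_A by (simp only: partition_on_insert[OF dj(1)] partition_on_insert[OF dj(2)] rest)
        (auto simp: \<beta>_def \<gamma>_def)
    have closed: "uminus ` b \<in> insert \<beta> (insert \<gamma> P) \<longleftrightarrow> uminus ` b \<in> P" if "b \<in> P" for b
    proof -
      have "m \<in> \<beta>" "- m \<in> \<gamma>" by (simp_all add: \<beta>_def \<gamma>_def)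
      then have "b \<noteq> \<beta>" "b \<noteq> \<gamma>"
        using that dj unfolding disjnt_def by blast+
      then have "uminus ` b \<noteq> \<gamma>" "uminus ` b \<noteq> \<beta>"
        using img uminus_image_uminus_image by metis+
      then show ?thesis by blast
    qed
    have attach: "attach_blocks m (X, Y, P) = insert \<beta> (insert \<gamma> P)"
      by (simp add: attach_blocks_def \<beta>_def \<gamma>_def)
    have "(\<forall>b\<in>insert \<beta> (insert \<gamma> P). uminus ` b \<in> insert \<beta> (insert \<gamma> P) \<and> uminus ` b \<noteq> b) \<longleftrightarrow>
        (\<forall>b\<in>P. uminus ` b \<in> P \<and> uminus ` b \<noteq> b)"
      using closed img ne by (simp add: Ball_def)
    with part show ?thesis
      by (simp only: attach signed_partitions_def mem_Collect_eq)
  qed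
  show "attach_blocks m ` ?D = signed_partitions (insert m R)"
  proof (intro equalityI subsetI)
    fix Q assume "Q \<in> attach_blocks m ` ?D"
    then obtain X Y P where Q: "Q = attach_blocks m (X, Y, P)" and sub: "X \<subseteq> R" "Y \<subseteq> R - X"
      and P: "P \<in> signed_partitions (R - X - Y)" by auto
    have "\<Union>P = (R - X - Y) \<union> uminus ` (R - X - Y)"
      using P by (rule Union_signed_partitions)
    then have "disjnt (insert m (X \<union> uminus ` Y)) (\<Union>P)" "disjnt (insert (- m) (uminus ` X \<union> Y)) (\<Union>P)"
      using sub m neg by (auto simp: disjnt_iff mem_uminus_image)
    with P sub show "Q \<in> signed_partitions (insert m R)" by (simp add: Q shape)
  next
    fix Q assume Q: "Q \<in> signed_partitions (insert m R)"
    then have un: "\<Union>Q = insert m R \<union> uminus ` insert m R" and dQ: "disjoint Q"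
      and cl: "\<And>b. b \<in> Q \<Longrightarrow> uminus ` b \<in> Q" "\<And>b. b \<in> Q \<Longrightarrow> uminus ` b \<noteq> b"
      by (auto simp: signed_partitions_def partition_on_def)
    from un obtain \<beta> where \<beta>: "\<beta> \<in> Q" "m \<in> \<beta>" by blast
    have dj: "\<beta> \<inter> uminus ` \<beta> = {}"
      using cl[OF \<beta>(1)] \<beta>(1) dQ by (metis disjointD)
    define X Y where "X = \<beta> \<inter> R" and "Y = uminus ` \<beta> \<inter> R"
    have sub: "X \<subseteq> R" "Y \<subseteq> R - X" using dj by (auto simp: X_def Y_def)
    have "\<beta> \<subseteq> insert m R \<union> uminus ` insert m R" using un \<beta> by blast
    moreover have "- m \<notin> \<beta>" using dj \<beta>(2) by (auto simp: mem_uminus_image)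
    ultimately have \<beta>_eq: "\<beta> = insert m (X \<union> uminus ` Y)"
      using \<beta>(2) by (auto simp: X_def Y_def mem_uminus_image)
    then have n\<beta>_eq: "uminus ` \<beta> = insert (- m) (uminus ` X \<union> Y)"
      by (simp add: image_Un image_image)
    define P where "P = Q - {\<beta>, uminus ` \<beta>}"
    have Q_eq: "Q = attach_blocks m (X, Y, P)"
      using \<beta> cl by (auto simp: attach_blocks_def P_def simp flip: \<beta>_eq n\<beta>_eq)
    have "disjnt \<beta> (\<Union>P)" "disjnt (uminus ` \<beta>) (\<Union>P)"
      using \<beta>(1) cl(1)[OF \<beta>(1)] by (auto simp only: P_def intro!: disjnt_Union_other_blocks[OF dQ])
    then have "P \<in> signed_partitions (R - X - Y)"
      using shape[OF sub, of P] Q Q_eq by (simp flip: \<beta>_eq n\<beta>_eq)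
    with sub Q_eq show "Q \<in> attach_blocks m ` ?D" by blast
  qed
qed

definition attach_zero_block :: "int set \<times> int set set \<Rightarrow> int set set" where
  "attach_zero_block = (\<lambda>(A, P). insert (insert 0 (A \<union> uminus ` A)) P)"

text \<open>The block of 0 meets its negative in 0, so it equals its negative. Uniqueness then says
  that the other blocks form a signed partition.\<close>
lemma bij_betw_attach_zero_block:
  "bij_betw attach_zero_block (SIGMA A:Pow {1..int n}. signed_partitions ({1..int n} - A))
    {P. type_B_partition n P}"
    (is "bij_betw _ ?D _")
proof (rule bij_betw_imageI)
  define S where "S = {1..int n}"
  have interval: "{- int n..int n} = insert 0 (S \<union> uminus ` S)"
    by (auto simp: S_def mem_uminus_image)
  have pos: "0 < x" if "x \<in> S" for x using that by (simp add: S_def)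
  have neg: "- x \<notin> S" if "x \<in> S" for x using that by (simp add: S_def)
  have zero: "0 \<notin> S" by (simp add: S_def)
  have D: "?D = (SIGMA A:Pow S. signed_partitions (S - A))" by (simp add: S_def)
  show "inj_on attach_zero_block ?D"
    unfolding D
  proof (rule inj_onI)
    fix p p' assume "p \<in> (SIGMA A:Pow S. signed_partitions (S - A))"
      "p' \<in> (SIGMA A:Pow S. signed_partitions (S - A))"
      and eq_p: "attach_zero_block p = attach_zero_block p'"
    then obtain A P A' P' where p: "p = (A, P)" "p' = (A', P')" and sub: "A \<subseteq> S" "A' \<subseteq> S"
      and P: "P \<in> signed_partitions (S - A)" "P' \<in> signed_partitions (S - A')"
      by auto
    define \<zeta> \<zeta>' where "\<zeta> = insert 0 (A \<union> uminus ` A)" and "\<zeta>' = insert 0 (A' \<union> uminus ` A')"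
    have un: "0 \<notin> \<Union>P" "0 \<notin> \<Union>P'"
      using zero by (auto simp: P[THEN Union_signed_partitions] mem_uminus_image simp del: Union_iff)
    have mm: "0 \<in> \<zeta>" "0 \<in> \<zeta>'" by (auto simp: \<zeta>_def \<zeta>'_def)
    have eq: "insert \<zeta> P = insert \<zeta>' P'"
      using eq_p by (simp add: p attach_zero_block_def \<zeta>_def \<zeta>'_def)
    then have "\<zeta> = \<zeta>'" using un mm by blast
    have "P = insert \<zeta> P - {\<zeta>}" "P' = insert \<zeta>' P' - {\<zeta>'}" using un mm by blast+
    then have "P = P'" using eq \<open>\<zeta> = \<zeta>'\<close> by metis
    moreover have "A = \<zeta> \<inter> S" "A' = \<zeta>' \<inter> S"
      using sub neg zero by (auto simp: \<zeta>_def \<zeta>'_def mem_uminus_image)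
    ultimately show "p = p'" unfolding p using \<open>\<zeta> = \<zeta>'\<close> by blast
  qed
  have part: "partition_on {- int n..int n} (insert (insert 0 (A \<union> uminus ` A)) P) \<longleftrightarrow>
      partition_on ((S - A) \<union> uminus ` (S - A)) P"
    if "A \<subseteq> S" "disjnt (insert 0 (A \<union> uminus ` A)) (\<Union>P)" for A P
  proof -
    have "{- int n..int n} - insert 0 (A \<union> uminus ` A) = (S - A) \<union> uminus ` (S - A)"
      using that(1) neg zero by (auto simp: interval mem_uminus_image)
    moreover have "insert 0 (A \<union> uminus ` A) \<subseteq> {- int n..int n}"
      using that(1) by (auto simp: interval)
    ultimately show ?thesis by (simp add: partition_on_insert[OF that(2)])
  qed
  show "attach_zero_block ` ?D = {P. type_B_partition n P}"
    unfolding D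
  proof (intro equalityI subsetI)
    fix Q assume "Q \<in> attach_zero_block ` (SIGMA A:Pow S. signed_partitions (S - A))"
    then obtain A P where Q: "Q = insert (insert 0 (A \<union> uminus ` A)) P" and sub: "A \<subseteq> S"
      and P: "P \<in> signed_partitions (S - A)" by (auto simp: attach_zero_block_def)
    have "disjnt (insert 0 (A \<union> uminus ` A)) (\<Union>P)"
      unfolding Union_signed_partitions[OF P] using sub neg zero by (auto simp: disjnt_iff mem_uminus_image)
    then have "partition_on {- int n..int n} Q"
      using P part[OF sub] by (simp add: Q signed_partitions_def)
    moreover have sym: "uminus ` insert 0 (A \<union> uminus ` A) = insert 0 (A \<union> uminus ` A)"
      by (auto simp: mem_uminus_image)
    have no_self: "uminus ` b \<noteq> b" if "b \<in> P" for b
      using P that by (simp add: signed_partitions_def)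
    have "\<exists>!\<beta>. \<beta> \<in> Q \<and> \<beta> = uminus ` \<beta>"
    proof (rule ex1I[of _ "insert 0 (A \<union> uminus ` A)"])
      show "\<beta> = insert 0 (A \<union> uminus ` A)" if "\<beta> \<in> Q \<and> \<beta> = uminus ` \<beta>" for \<beta>
        using that no_self by (metis Q insertE)
    qed (simp only: Q sym insertI1 simp_thms)
    moreover have "\<forall>\<beta>\<in>Q. uminus ` \<beta> \<in> Q"
      using P sym by (simp add: Q signed_partitions_def)
    ultimately have "type_B_partition n Q"
      by (simp add: type_B_partition_def)
    then show "Q \<in> {P. type_B_partition n P}" by simp
  next
    fix Q assume "Q \<in> {P. type_B_partition n P}"
    then have pQ: "partition_on {- int n..int n} Q" and cl: "\<And>b. b \<in> Q \<Longrightarrow> uminus ` b \<in> Q"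
      and uniq: "\<exists>!\<beta>. \<beta> \<in> Q \<and> \<beta> = uminus ` \<beta>"
      by (auto simp: type_B_partition_def)
    have un: "\<Union>Q = insert 0 (S \<union> uminus ` S)" and dQ: "disjoint Q"
      using pQ by (auto simp: partition_on_def interval)
    from un obtain \<zeta> where \<zeta>: "\<zeta> \<in> Q" "0 \<in> \<zeta>" by blast
    have "0 \<in> \<zeta> \<inter> uminus ` \<zeta>" using \<zeta>(2) by (auto simp: mem_uminus_image)
    then have \<zeta>_neg: "uminus ` \<zeta> = \<zeta>"
      using disjointD[OF dQ \<zeta>(1) cl[OF \<zeta>(1)]] by auto
    define A where "A = \<zeta> \<inter> S"
    define P where "P = Q - {\<zeta>}"
    have "\<zeta> \<subseteq> insert 0 (S \<union> uminus ` S)" using un \<zeta> by blast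
    moreover have "- x \<in> \<zeta> \<longleftrightarrow> x \<in> \<zeta>" for x using \<zeta>_neg by (metis mem_uminus_image)
    ultimately have \<zeta>_eq: "\<zeta> = insert 0 (A \<union> uminus ` A)"
      using \<zeta>(2) by (auto simp: A_def mem_uminus_image)
    have Q_eq: "Q = insert \<zeta> P" using \<zeta> by (auto simp: P_def)
    have "disjnt \<zeta> (\<Union>P)"
      using \<zeta>(1) by (auto simp only: P_def intro!: disjnt_Union_other_blocks[OF dQ])
    then have "partition_on ((S - A) \<union> uminus ` (S - A)) P"
      using part[of A P] pQ by (simp add: Q_eq A_def[symmetric] \<zeta>_eq[symmetric]) (simp add: A_def)
    moreover have "uminus ` b \<in> P \<and> uminus ` b \<noteq> b" if "b \<in> P" for b
      using that cl[of b] uniq \<zeta> \<zeta>_neg uminus_image_uminus_image[of b] unfolding P_def by (metis Diff_iff singleton_iff)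
    ultimately have "P \<in> signed_partitions (S - A)" by (simp add: signed_partitions_def)
    moreover have "Q = attach_zero_block (A, P)" by (simp add: attach_zero_block_def Q_eq \<zeta>_eq)
    moreover have "A \<in> Pow S" by (simp add: A_def)
    ultimately show "Q \<in> attach_zero_block ` (SIGMA A:Pow S. signed_partitions (S - A))" by blast
  qed
qed

lemma finite_signed_partitions: "finite S \<Longrightarrow> finite (signed_partitions S)"
  unfolding signed_partitions_def
  by (rule finite_subset[OF _ finitely_many_partition_on[of "S \<union> uminus ` S"]]) auto

lemma card_signed_partitions_insert:
  assumes "finite R" "m \<notin> R" "\<forall>x\<in>insert m R. 0 < x"
  shows "card (signed_partitions (insert m R)) =
    (\<Sum>X\<in>Pow R. \<Sum>Y\<in>Pow (R - X). card (signed_partitions (R - X - Y)))"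
proof -
  have "card (signed_partitions (insert m R)) =
    card (SIGMA X:Pow R. SIGMA Y:Pow (R - X). signed_partitions (R - X - Y))"
    using bij_betw_same_card[OF bij_betw_attach_blocks[OF assms(2,3)]] by simp
  also have "\<dots> = (\<Sum>X\<in>Pow R. \<Sum>Y\<in>Pow (R - X). card (signed_partitions (R - X - Y)))"
    using assms(1) by (simp add: finite_signed_partitions)
  finally show ?thesis .
qed

lemma dowling_eq_sum: "dowling n = (\<Sum>A\<in>Pow {1..int n}. card (signed_partitions ({1..int n} - A)))"
proof -
  have "dowling n = card (SIGMA A:Pow {1..int n}. signed_partitions ({1..int n} - A))"
    unfolding dowling_def using bij_betw_same_card[OF bij_betw_attach_zero_block] by simp
  then show ?thesis by (simp add: finite_signed_partitions)
qed

section \<open>Comparison of the two counts\<close>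

text \<open>A bijection between the base sets carries one sum to the other. Applied twice, this compares the
  double sums of the two recursions without any binomial coefficients.\<close>
lemma sum_Pow_complement_cong:
  fixes f :: "'a set \<Rightarrow> nat" and g :: "'b set \<Rightarrow> nat"
  assumes fin: "finite A" "finite B" and card: "card A = card B"
    and eq: "\<And>U V. U \<subseteq> A \<Longrightarrow> V \<subseteq> B \<Longrightarrow> card U = card V \<Longrightarrow> f U = g V"
  shows "(\<Sum>X\<in>Pow A. f (A - X)) = (\<Sum>X\<in>Pow B. g (B - X))"
proof -
  obtain h where h: "bij_betw h A B" using fin card finite_same_card_bij by blast
  have "(\<Sum>X\<in>Pow A. f (A - X)) = (\<Sum>X\<in>Pow A. g (B - h ` X))"
  proof (rule sum.cong[OF refl])
    fix X assume X: "X \<in> Pow A"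
    then have "B - h ` X = h ` (A - X)"
      using h by (auto simp: bij_betw_def inj_on_def)
    moreover have "card (h ` (A - X)) = card (A - X)"
      using h by (intro card_image) (auto simp: bij_betw_def inj_on_def)
    ultimately show "f (A - X) = g (B - h ` X)" by (intro eq) auto
  qed
  also have "\<dots> = (\<Sum>X\<in>Pow B. g (B - X))"
    using sum.reindex_bij_betw[OF bij_betw_Pow[OF h], of "\<lambda>X. g (B - X)"] by simp
  finally show ?thesis .
qed

lemma almost_flattened_empty [simp]: "almost_flattened {} = {[]}"
  by (auto simp: almost_flattened_def stirling_words_def nested_def)

lemma signed_partitions_empty [simp]: "signed_partitions {} = {{}}"
  by (auto simp: signed_partitions_def partition_on_empty)

text \<open>Both sides obey one recursion over pairs of disjoint subsets. Its terms belong to smaller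
  sets, of which by induction only the sizes matter.\<close>
theorem card_almost_flattened_eq_signed_partitions:
  fixes S :: "'a::linorder set"
  assumes "finite S" "finite T" "card S = card T" "\<forall>x\<in>T. 0 < x"
  shows "card (almost_flattened S) = card (signed_partitions T)"
  using assms
proof (induction "card S" arbitrary: S T rule: less_induct)
  case less
  show ?case
  proof (cases "S = {}")
    case True
    with less.prems show ?thesis by simp
  next
    case False
    with less.prems have "T \<noteq> {}" by auto
    then obtain k where k: "k \<in> T" by blast
    define m where "m = Min S"
    have m: "m \<in> S" "\<forall>x\<in>S. m \<le> x" using False less.prems by (simp_all add: m_def)
    define A B where "A = S - {m}" and "B = T - {k}"
    have S: "S = insert m A" and T: "T = insert k B" using m k by (auto simp: A_def B_def)
    have fin: "finite A" "finite B" using less.prems by (simp_all add: A_def B_def)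
    have card: "card A = card B" using less.prems m k by (simp add: A_def B_def)
    have smaller: "card A < card S" unfolding A_def using less.prems(1) m(1) by (rule card_Diff1_less)
    have IH: "card (almost_flattened U) = card (signed_partitions V)"
      if "U \<subseteq> A" "V \<subseteq> B" "card U = card V" for U V
    proof (rule less.hyps)
      show "card U < card S" using that(1) fin(1) smaller card_mono le_less_trans by blast
      show "\<forall>x\<in>V. 0 < x" using that(2) less.prems(4) by (auto simp: B_def)
    qed (use that fin finite_subset in blast)+
    have "card (almost_flattened S) =
        (\<Sum>X\<in>Pow A. \<Sum>Y\<in>Pow (A - X). card (almost_flattened (A - X - Y)))"
      unfolding S using fin(1) m
      by (intro card_almost_flattened_insert) (auto simp: A_def less_le)
    also have "\<dots> = (\<Sum>X\<in>Pow B. \<Sum>Y\<in>Pow (B - X). card (signed_partitions (B - X - Y)))"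
    proof (rule sum_Pow_complement_cong[OF fin card])
      fix U V assume UV: "U \<subseteq> A" "V \<subseteq> B" "card U = card V"
      show "(\<Sum>Y\<in>Pow U. card (almost_flattened (U - Y))) = (\<Sum>Y\<in>Pow V. card (signed_partitions (V - Y)))"
      proof (rule sum_Pow_complement_cong)
        show "finite U" "finite V" using UV fin finite_subset by blast+
        show "card (almost_flattened U') = card (signed_partitions V')"
          if "U' \<subseteq> U" "V' \<subseteq> V" "card U' = card V'" for U' V'
          using that UV by (intro IH) auto
      qed fact
    qed
    also have "\<dots> = card (signed_partitions T)"
      unfolding T using fin(2) less.prems(4)
      by (intro card_signed_partitions_insert[symmetric]) (auto simp: B_def k)
    finally show ?thesis .
  qed
qed

theorem corollary3p11:
  fixes n :: nat
  assumes "n \<ge> 1"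
  shows "card (flat (stirling_permutations (n + 1))) = dowling n"
proof -
  have "{1..n + 1} = insert 1 {2..n + 1}" by auto
  then have "card (flat (stirling_permutations (n + 1))) =
      (\<Sum>Y\<in>Pow {2..n + 1}. card (almost_flattened ({2..n + 1} - Y)))"
    unfolding stirling_permutations_eq by (simp only:) (rule card_flat_stirling_words; simp)
  also have "\<dots> = (\<Sum>A\<in>Pow {1..int n}. card (signed_partitions ({1..int n} - A)))"
  proof (rule sum_Pow_complement_cong)
    show "card (almost_flattened U) = card (signed_partitions V)"
      if "U \<subseteq> {2..n + 1}" "V \<subseteq> {1..int n}" "card U = card V" for U V
      using that by (intro card_almost_flattened_eq_signed_partitions) (auto intro: finite_subset)
  qed simp_all
  also have "\<dots> = dowling n" by (rule dowling_eq_sum[symmetric])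
  finally show ?thesis .
qed

end
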